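(* Let $\|\cdot\|$ be a norm on $\mathbb{R}^n$, $\mathcal{X}\subset\mathbb{R}^n$ compact and convex, and $\Phi:\mathcal{D}\to\mathbb{R}$ a mirror map that is $1$-strongly convex on $\mathcal{X}\cap\mathcal{D}$ with respect to $\|\cdot\|$. Let $x_1\in\mathrm{argmin}_{x\in\mathcal{X}\cap\mathcal{D}}\Phi(x)$ and $R^2=\sup_{x\in\mathcal{X}\cap\mathcal{D}}\Phi(x)-\Phi(x_1)$. Let $f:\mathcal{X}\to\mathbb{R}$ be convex, with a stochastic oracle $\tilde g$ such that $\mathbb{E}\|\tilde g(x)\|_*^2\le B^2$ for all $x\in\mathcal{X}$, $B>0$. Fix $t\ge 1$ and let stochastic mirror descent with $\eta=\frac RB\sqrt{\frac2t}$ be defined by $$x_{s+1}=\mathrm{argmin}_{x\in\mathcal{X}\cap\mathcal{D}}\ \eta\,\tilde g(x_s)^\top x+D_\Phi(x,x_s),\qquad s\ge 1.$$ Then $$\mathbb{E}f\left(\frac1t\sum_{s=1}^tx_s\right)-\min_{x\in\mathcal{X}}f(x)\le RB\sqrt{\frac2t}.$$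
   Context: The dual norm is $\|g\|_*=\sup_{\|x\|\le1}g^\top x$. $\partial f(x)$ is the set of $g$ with $f(x)-f(y)\le g^\top(x-y)$ for all $y\in\mathcal{X}$. A (first order) stochastic oracle for $f$ takes $x\in\mathcal{X}$ and outputs a random vector $\tilde g(x)$ with $\mathbb{E}\,\tilde g(x)\in\partial f(x)$; when the query point $x$ is itself random (possibly depending on previous oracle answers), one has $\mathbb{E}(\tilde g(x)\mid x)\in\partial f(x)$, and the second moment bound holds likewise at the random query points. Mirror map: $\mathcal{D}\subset\mathbb{R}^n$ is a convex open set with $\mathcal{X}\subset\overline{\mathcal{D}}$ and $\mathcal{X}\cap\mathcal{D}\ne\emptyset$; $\Phi:\mathcal{D}\to\mathbb{R}$ is a mirror map if (i) it is strictly convex and differentiable, (ii) $\nabla\Phi(\mathcal{D})=\mathbb{R}^n$, (iii) $\|\nabla\Phi(x)\|\to+\infty$ as $x\to\partial\mathcal{D}$. $\Phi$ is $1$-strongly convex on $\mathcal{X}\cap\mathcal{D}$ w.r.t. $\|\cdot\|$ if $\Phi(x)-\Phi(y)\le\nabla\Phi(x)^\top(x-y)-\frac12\|x-y\|^2$ for all $x,y\in\mathcal{X}\cap\mathcal{D}$. Bregman divergence: $D_\Phi(x,y)=\Phi(x)-\Phi(y)-\nabla\Phi(y)^\top(x-y)$. *)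

theory Defs
  imports "HOL-Probability.Probability"
begin

definition is_norm :: "('a::real_vector \<Rightarrow> real) \<Rightarrow> bool" where
  "is_norm N \<longleftrightarrow>
     (\<forall>x. N x \<ge> 0) \<and>
     (\<forall>x. N x = 0 \<longleftrightarrow> x = 0) \<and>
     (\<forall>c x. N (c *\<^sub>R x) = \<bar>c\<bar> * N x) \<and>
     (\<forall>x y. N (x + y) \<le> N x + N y)"

definition dual_norm :: "('a::real_inner \<Rightarrow> real) \<Rightarrow> 'a \<Rightarrow> real" where
  "dual_norm N g = (SUP x\<in>{x. N x \<le> 1}. g \<bullet> x)"

definition subdifferential :: "'a::real_inner set \<Rightarrow> ('a \<Rightarrow> real) \<Rightarrow> 'a \<Rightarrow> 'a set" where
  "subdifferential X f x = {g. \<forall>y\<in>X. f x - f y \<le> g \<bullet> (x - y)}"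

(* Meaningful only where f is differentiable. *)
definition grad :: "('a::real_inner \<Rightarrow> real) \<Rightarrow> 'a \<Rightarrow> 'a" where
  "grad f x = (THE g. GDERIV f x :> g)"

definition strictly_convex_on :: "'a::real_vector set \<Rightarrow> ('a \<Rightarrow> real) \<Rightarrow> bool" where
  "strictly_convex_on S f \<longleftrightarrow> convex S \<and>
     (\<forall>x\<in>S. \<forall>y\<in>S. \<forall>u>0. \<forall>v>0. x \<noteq> y \<longrightarrow> u + v = 1 \<longrightarrow>
        f (u *\<^sub>R x + v *\<^sub>R y) < u * f x + v * f y)"

(* \<Phi> is a total function, but only its values on the open set D matter.
   The last condition reads "x tends to the boundary of D" as: x tends to some boundary
   point of D while staying in D. *)
definition mirror_map :: "('a::euclidean_space \<Rightarrow> real) \<Rightarrow> 'a set \<Rightarrow> ('a \<Rightarrow> real) \<Rightarrow> bool" where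
  "mirror_map N D \<Phi> \<longleftrightarrow>
     strictly_convex_on D \<Phi> \<and>
     (\<forall>x\<in>D. \<Phi> differentiable (at x)) \<and>
     grad \<Phi> ` D = UNIV \<and>
     (\<forall>z\<in>frontier D. filterlim (\<lambda>x. N (grad \<Phi> x)) at_top (at z within D))"

definition strongly_convex_wrt ::
  "('a::real_inner \<Rightarrow> real) \<Rightarrow> real \<Rightarrow> 'a set \<Rightarrow> ('a \<Rightarrow> real) \<Rightarrow> bool" where
  "strongly_convex_wrt N \<alpha> S \<Phi> \<longleftrightarrow>
     (\<forall>x\<in>S. \<forall>y\<in>S. \<Phi> x - \<Phi> y \<le> grad \<Phi> x \<bullet> (x - y) - \<alpha> / 2 * (N (x - y))\<^sup>2)"

definition bregman :: "('a::real_inner \<Rightarrow> real) \<Rightarrow> 'a \<Rightarrow> 'a \<Rightarrow> real" where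
  "bregman \<Phi> x y = \<Phi> x - \<Phi> y - grad \<Phi> y \<bullet> (x - y)"

(* E(V | Y) for random vectors V and Y: the componentwise conditional expectation
   with respect to the sigma-algebra generated by Y. *)
definition vec_cond_exp ::
  "'w measure \<Rightarrow> ('w \<Rightarrow> real^'n) \<Rightarrow> ('w \<Rightarrow> real^'n) \<Rightarrow> 'w \<Rightarrow> real^'n" where
  "vec_cond_exp M V Y \<omega> =
     (\<chi> i. real_cond_exp M (vimage_algebra (space M) Y borel) (\<lambda>\<omega>'. V \<omega>' $ i) \<omega>)"

(* One call to an oracle is a random field g: the answer at the query point x is the random
   vector "g x".  This definition covers deterministic query points. *)
definition stochastic_oracle ::
  "'w measure \<Rightarrow> (real^'n) set \<Rightarrow> (real^'n \<Rightarrow> real) \<Rightarrow> (real^'n \<Rightarrow> 'w \<Rightarrow> real^'n) \<Rightarrow> bool" where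
  "stochastic_oracle M X f g \<longleftrightarrow>
     (\<forall>x\<in>X. integrable M (g x) \<and> integral\<^sup>L M (g x) \<in> subdifferential X f x)"

(* The same at a random query point q: the answer is the random vector
   "\<lambda>\<omega>. g (q \<omega>) \<omega>".  This does not follow from stochastic_oracle, because q may depend on
   the past and g need not be independent of it. *)
definition stochastic_oracle_at ::
  "'w measure \<Rightarrow> (real^'n) set \<Rightarrow> (real^'n \<Rightarrow> real) \<Rightarrow> (real^'n \<Rightarrow> 'w \<Rightarrow> real^'n) \<Rightarrow>
     ('w \<Rightarrow> real^'n) \<Rightarrow> bool" where
  "stochastic_oracle_at M X f g q \<longleftrightarrow>
     integrable M (\<lambda>\<omega>. g (q \<omega>) \<omega>) \<and>
     (AE \<omega> in M. vec_cond_exp M (\<lambda>\<omega>'. g (q \<omega>') \<omega>') q \<omega> \<in> subdifferential X f (q \<omega>))"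

(* E ||V||_*^2 \<le> B^2, as a Lebesgue integral of a nonnegative function, so that an infinite
   second moment is not accepted. *)
definition second_moment_le ::
  "'w measure \<Rightarrow> ('a::euclidean_space \<Rightarrow> real) \<Rightarrow> ('w \<Rightarrow> 'a) \<Rightarrow> real \<Rightarrow> bool" where
  "second_moment_le M N V B \<longleftrightarrow>
     (\<integral>\<^sup>+ \<omega>. ennreal ((dual_norm N (V \<omega>))\<^sup>2) \<partial>M) \<le> ennreal (B\<^sup>2)"

(* x s is the s-th iterate and g s the s-th oracle call, with s starting at 1. *)
definition stochastic_mirror_descent ::
  "'w measure \<Rightarrow> (real^'n) set \<Rightarrow> (real^'n) set \<Rightarrow> (real^'n \<Rightarrow> real) \<Rightarrow> real \<Rightarrow> real^'n \<Rightarrow>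
     (nat \<Rightarrow> real^'n \<Rightarrow> 'w \<Rightarrow> real^'n) \<Rightarrow> (nat \<Rightarrow> 'w \<Rightarrow> real^'n) \<Rightarrow> bool" where
  "stochastic_mirror_descent M X D \<Phi> \<eta> x1 g x \<longleftrightarrow>
     (\<forall>\<omega>\<in>space M. x 1 \<omega> = x1 \<and>
       (\<forall>s\<ge>1. is_arg_min (\<lambda>z. \<eta> * (g s (x s \<omega>) \<omega> \<bullet> z) + bregman \<Phi> z (x s \<omega>))
                 (\<lambda>z. z \<in> X \<inter> D) (x (Suc s) \<omega>)))"

end

theory Submission
  imports Defs
begin

text \<open>
  Along each sample path mirror descent is a deterministic algorithm fed with the vectors
  \<open>g s (x s \<omega>) \<omega>\<close>, and \<open>\<eta>\<close> times its linearised regret against any \<open>y\<close> in \<open>X \<inter> D\<close> is bounded by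
  \<open>R\<^sup>2 + \<eta>\<^sup>2 / 2\<close> times the sum of the squared dual norms (lemma \<open>mirror_descent_regret\<close>): each step
  trades a decrease of the Bregman divergence to \<open>y\<close> against the linear loss, and strong convexity pays
  for the error made by moving. Taking expectations, the second moment bound controls the right-hand
  side, and the left-hand side dominates the expected suboptimality of the iterates, because \<open>x s - y\<close> is
  a function of the query point and the answer is conditionally a subgradient there (lemma
  \<open>stochastic_oracle_at_suboptimality\<close>). Jensen's inequality for the average of the iterates and the value
  of \<open>\<eta>\<close>, which balances the two terms, give the rate.

  What remains is regularity. The expectations make sense because the iterates are measurable: one mirror
  step is a Lipschitz function of \<open>\<eta> g - \<nabla>\<Phi>(x)\<close> (lemma \<open>borel_measurable_mirror_step\<close>). The
  objective is continuous on the compact set \<open>X\<close>, since the oracle provides bounded subgradients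
  everywhere (lemma \<open>stochastic_oracle_continuous_on\<close>); this yields integrability, the existence of
  a minimiser, and the passage from comparison points in \<open>X \<inter> D\<close> to all of \<open>X\<close>. When \<open>R = 0\<close> the
  step size vanishes and the regret bound is void, but then \<open>X \<inter> D\<close> is a single point.
\<close>

section \<open>Norms and their duals\<close>

lemma
  assumes "is_norm N"
  shows is_norm_nonneg: "N x \<ge> 0"
    and is_norm_eq_0_iff: "N x = 0 \<longleftrightarrow> x = 0"
    and is_norm_scaleR: "N (c *\<^sub>R x) = \<bar>c\<bar> * N x"
    and is_norm_triangle: "N (x + y) \<le> N x + N y"
  using assms unfolding is_norm_def by blast+

lemma is_norm_0: "is_norm N \<Longrightarrow> N 0 = 0"
  by (simp add: is_norm_eq_0_iff)

lemma is_norm_convex_on: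
  assumes "is_norm N"
  shows "convex_on UNIV N"
proof (rule convex_onI)
  fix r :: real and x y :: 'a
  assume r: "0 < r" "r < 1"
  have "N ((1 - r) *\<^sub>R x + r *\<^sub>R y) \<le> N ((1 - r) *\<^sub>R x) + N (r *\<^sub>R y)"
    by (rule is_norm_triangle[OF assms])
  also have "\<dots> = (1 - r) * N x + r * N y"
    using r by (simp add: is_norm_scaleR[OF assms])
  finally show "N ((1 - r) *\<^sub>R x + r *\<^sub>R y) \<le> (1 - r) * N x + r * N y" .
qed simp

lemma is_norm_minus_commute:
  assumes "is_norm N"
  shows "N (x - y) = N (y - x)"
  using is_norm_scaleR[OF assms, of "-1" "x - y"] by simp

text \<open>
  All norms on a finite-dimensional space are equivalent. The half used here has
  \<open>1 / K\<close> equal to the minimum of \<open>N\<close> on the Euclidean unit sphere: it bounds the unit ball of \<open>N\<close>, so that the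
  supremum in the dual norm is finite, and it turns a Lipschitz bound in \<open>N\<close> into a Euclidean one.
\<close>
lemma is_norm_bounds_norm:
  fixes N :: "'a::euclidean_space \<Rightarrow> real"
  assumes N: "is_norm N"
  obtains K where "K > 0" "\<And>x. norm x \<le> K * N x"
proof -
  have cont: "continuous_on (sphere 0 1) N"
    using convex_on_continuous[OF open_UNIV is_norm_convex_on[OF N]] continuous_on_subset by blast
  have "sphere (0::'a) 1 \<noteq> {}" by simp
  then obtain u where u: "u \<in> sphere 0 1" "\<And>y. y \<in> sphere 0 1 \<Longrightarrow> N u \<le> N y"
    using continuous_attains_inf[OF compact_sphere _ cont] by auto
  have "u \<noteq> 0" using u(1) by auto
  then have pos: "N u > 0" using is_norm_nonneg[OF N, of u] is_norm_eq_0_iff[OF N, of u] by linarith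
  have "norm x \<le> (1 / N u) * N x" for x
  proof (cases "x = 0")
    case True
    then show ?thesis by (simp add: is_norm_0[OF N])
  next
    case False
    have "N u \<le> N ((1 / norm x) *\<^sub>R x)" using u(2) False by simp
    also have "\<dots> = N x / norm x" by (simp add: is_norm_scaleR[OF N])
    finally have "N u * norm x \<le> N x"
      using False by (simp add: pos_le_divide_eq)
    then show ?thesis using pos by (simp add: pos_le_divide_eq mult.commute)
  qed
  then show ?thesis using that[of "1 / N u"] pos by auto
qed

lemma bdd_above_dual_norm:
  fixes N :: "'a::euclidean_space \<Rightarrow> real"
  assumes N: "is_norm N"
  shows "bdd_above ((\<lambda>x. g \<bullet> x) ` {x. N x \<le> 1})"
proof -
  obtain K where K: "K > 0" "\<And>x. norm x \<le> K * N x" using is_norm_bounds_norm[OF N] by metis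
  have "g \<bullet> x \<le> norm g * K" if "N x \<le> 1" for x
  proof -
    have "g \<bullet> x \<le> norm g * norm x" by (rule norm_cauchy_schwarz)
    also have "norm x \<le> K * 1" using K(2)[of x] mult_left_mono[OF that, of K] K(1) by linarith
    finally show ?thesis by (simp add: mult_left_mono)
  qed
  then show ?thesis by (auto intro!: bdd_aboveI)
qed

lemma inner_le_dual_norm:
  fixes N :: "'a::euclidean_space \<Rightarrow> real"
  assumes N: "is_norm N"
  shows "g \<bullet> x \<le> dual_norm N g * N x"
proof (cases "x = 0")
  case True
  then show ?thesis by (simp add: is_norm_0[OF N])
next
  case False
  then have pos: "N x > 0" using is_norm_nonneg[OF N, of x] is_norm_eq_0_iff[OF N, of x] by linarith
  have "N ((1 / N x) *\<^sub>R x) = 1" using pos by (simp add: is_norm_scaleR[OF N])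
  then have "g \<bullet> ((1 / N x) *\<^sub>R x) \<le> dual_norm N g"
    unfolding dual_norm_def by (intro cSUP_upper bdd_above_dual_norm[OF N]) auto
  then show ?thesis using pos by (simp add: pos_divide_le_eq)
qed

lemma dual_norm_nonneg:
  fixes N :: "'a::euclidean_space \<Rightarrow> real"
  assumes N: "is_norm N"
  shows "dual_norm N g \<ge> 0"
proof -
  have "g \<bullet> 0 \<le> dual_norm N g"
    unfolding dual_norm_def
    by (intro cSUP_upper bdd_above_dual_norm[OF N]) (simp add: is_norm_0[OF N])
  then show ?thesis by simp
qed

text \<open>
  As a pointwise supremum of linear functions, finite everywhere, the dual norm is convex, hence
  continuous. Continuity makes the squared dual norm of a random vector measurable.
\<close>
lemma continuous_on_dual_norm:
  fixes N :: "'a::euclidean_space \<Rightarrow> real"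
  assumes N: "is_norm N"
  shows "continuous_on UNIV (dual_norm N)"
proof (rule convex_on_continuous[OF open_UNIV], rule convex_onI)
  fix r :: real and g h :: 'a
  assume r: "0 < r" "r < 1"
  have "0 \<in> {x. N x \<le> 1}" by (simp add: is_norm_0[OF N])
  then have "{x. N x \<le> 1} \<noteq> {}" by blast
  then show "dual_norm N ((1 - r) *\<^sub>R g + r *\<^sub>R h) \<le> (1 - r) * dual_norm N g + r * dual_norm N h"
    unfolding dual_norm_def[of N "(1 - r) *\<^sub>R g + r *\<^sub>R h"]
  proof (rule cSUP_least)
    fix x assume "x \<in> {x. N x \<le> 1}"
    then have "g \<bullet> x \<le> dual_norm N g" "h \<bullet> x \<le> dual_norm N h"
      unfolding dual_norm_def by (intro cSUP_upper bdd_above_dual_norm[OF N]; simp)+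
    then show "((1 - r) *\<^sub>R g + r *\<^sub>R h) \<bullet> x \<le> (1 - r) * dual_norm N g + r * dual_norm N h"
      using r by (auto simp: inner_add_left intro!: add_mono)
  qed
qed simp

text \<open>
  The hypothesis on second moments is an integral bound in the extended nonnegative reals. For a
  measurable random vector it gives integrability, so the rest can be computed with real integrals.
\<close>
lemma second_moment_le_integral:
  fixes N :: "'a::euclidean_space \<Rightarrow> real"
  assumes N: "is_norm N" and V: "V \<in> borel_measurable M" and sm: "second_moment_le M N V B"
  shows "integrable M (\<lambda>\<omega>. (dual_norm N (V \<omega>))\<^sup>2)"
    and "(\<integral>\<omega>. (dual_norm N (V \<omega>))\<^sup>2 \<partial>M) \<le> B\<^sup>2"
proof -
  have "dual_norm N \<in> borel_measurable borel"
    by (rule borel_measurable_continuous_onI[OF continuous_on_dual_norm[OF N]])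
  then have meas: "(\<lambda>\<omega>. (dual_norm N (V \<omega>))\<^sup>2) \<in> borel_measurable M"
    using V by measurable
  have le: "(\<integral>\<^sup>+ \<omega>. ennreal ((dual_norm N (V \<omega>))\<^sup>2) \<partial>M) \<le> ennreal (B\<^sup>2)"
    using sm by (simp add: second_moment_le_def)
  show int: "integrable M (\<lambda>\<omega>. (dual_norm N (V \<omega>))\<^sup>2)"
    using le by (intro integrableI_nonneg meas) (auto intro: le_less_trans)
  show "(\<integral>\<omega>. (dual_norm N (V \<omega>))\<^sup>2 \<partial>M) \<le> B\<^sup>2"
    using le by (subst (asm) nn_integral_eq_integral[OF int]) auto
qed

section \<open>Gradients, optimality conditions and the mirror step\<close>

lemma gderiv_grad:
  fixes \<Phi> :: "'a::euclidean_space \<Rightarrow> real"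
  assumes "\<Phi> differentiable (at x)"
  shows "GDERIV \<Phi> x :> grad \<Phi> x"
proof -
  obtain d where d: "(\<Phi> has_derivative d) (at x)" using assms by (auto simp: differentiable_def)
  then have lin: "linear d" by (rule has_derivative_linear)
  have "d = (\<lambda>h. h \<bullet> adjoint d 1)"
    using adjoint_works[OF lin, of _ 1] by (auto simp: inner_commute)
  then have ex: "GDERIV \<Phi> x :> adjoint d 1" using d by (simp add: gderiv_def)
  have "a = b" if "GDERIV \<Phi> x :> a" "GDERIV \<Phi> x :> b" for a b
  proof -
    have "(\<lambda>h. h \<bullet> a) = (\<lambda>h. h \<bullet> b)"
      using that unfolding gderiv_def by (rule has_derivative_unique)
    then show ?thesis by (metis inner_commute vector_eq_ldot)
  qed
  with ex have "grad \<Phi> x = adjoint d 1" unfolding grad_def by (intro the_equality) blast+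
  with ex show ?thesis by simp
qed

text \<open>
  Both uses of gradients below are one-dimensional: the first-order condition at a minimiser and the
  recovery of the gradient from difference quotients.
\<close>
lemma gderiv_along_line:
  assumes "GDERIV h p :> d"
  shows "((\<lambda>u. h (p + u *\<^sub>R v)) has_real_derivative d \<bullet> v) (at 0)"
proof -
  have line: "((\<lambda>u. p + u *\<^sub>R v) has_derivative (\<lambda>u. u *\<^sub>R v)) (at 0)"
    by (auto intro!: derivative_eq_intros)
  have "(h has_derivative (\<lambda>w. w \<bullet> d)) (at ((\<lambda>u. p + u *\<^sub>R v) 0))"
    using assms by (simp add: gderiv_def)
  then have "((\<lambda>u. h (p + u *\<^sub>R v)) has_derivative (\<lambda>u. (u *\<^sub>R v) \<bullet> d)) (at 0)"
    by (rule has_derivative_compose[OF line, where g = h])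
  moreover have "(\<lambda>u. (u *\<^sub>R v) \<bullet> d) = (*) (d \<bullet> v)"
    by (auto simp: inner_commute)
  ultimately show ?thesis by (simp add: has_field_derivative_def)
qed

lemma is_arg_min_real_le:
  fixes h :: "'a \<Rightarrow> real"
  assumes "is_arg_min h P p" "P z"
  shows "h p \<le> h z"
  using assms by (auto simp: is_arg_min_def not_less)

text \<open>
  If the derivative at \<open>p\<close> in the feasible direction \<open>z - p\<close> were negative, a short step towards \<open>z\<close>
  would stay in \<open>S\<close> and decrease \<open>h\<close>.
\<close>
lemma arg_min_first_order:
  fixes h :: "'a::euclidean_space \<Rightarrow> real"
  assumes S: "convex S" and min: "is_arg_min h (\<lambda>z. z \<in> S) p"
    and grad: "GDERIV h p :> d" and z: "z \<in> S"
  shows "0 \<le> d \<bullet> (z - p)"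
proof (rule ccontr)
  assume neg: "\<not> ?thesis"
  have p: "p \<in> S" using min by (simp add: is_arg_min_def)
  from DERIV_neg_dec_right[OF gderiv_along_line[OF grad, of "z - p"]] neg obtain e where
    e: "e > 0" "\<And>u. 0 < u \<Longrightarrow> u < e \<Longrightarrow> h (p + u *\<^sub>R (z - p)) < h p"
    by auto
  define u where "u = min (e / 2) 1"
  have u: "0 < u" "u < e" "u \<le> 1" using e(1) by (auto simp: u_def)
  have "p + u *\<^sub>R (z - p) = (1 - u) *\<^sub>R p + u *\<^sub>R z" by (simp add: algebra_simps)
  also have "\<dots> \<in> S" using S p z u by (intro convexD) auto
  finally have "h p \<le> h (p + u *\<^sub>R (z - p))" using is_arg_min_real_le[OF min] by blast
  with e(2)[OF u(1,2)] show False by simp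
qed

text \<open>
  The part of the objective that depends on \<open>z\<close> is \<open>\<eta> (g \<bullet> z) + \<Phi> z - \<nabla>\<Phi>(x) \<bullet> z\<close>, and the vector in the
  conclusion is its gradient at \<open>p\<close>.
\<close>
lemma mirror_step_first_order:
  fixes \<Phi> :: "'a::euclidean_space \<Rightarrow> real"
  assumes S: "convex S" and diff: "\<And>z. z \<in> S \<Longrightarrow> \<Phi> differentiable (at z)"
    and min: "is_arg_min (\<lambda>z. \<eta> * (g \<bullet> z) + bregman \<Phi> z x) (\<lambda>z. z \<in> S) p"
    and z: "z \<in> S"
  shows "0 \<le> (\<eta> *\<^sub>R g + grad \<Phi> p - grad \<Phi> x) \<bullet> (z - p)"
proof (rule arg_min_first_order[OF S min _ z])
  have "p \<in> S" using min by (simp add: is_arg_min_def)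
  then have D: "(\<Phi> has_derivative (\<lambda>h. h \<bullet> grad \<Phi> p)) (at p)"
    using gderiv_grad[OF diff] by (simp add: gderiv_def)
  show "GDERIV (\<lambda>z. \<eta> * (g \<bullet> z) + bregman \<Phi> z x) p :> \<eta> *\<^sub>R g + grad \<Phi> p - grad \<Phi> x"
    unfolding gderiv_def bregman_def
    by (auto intro!: derivative_eq_intros D simp: inner_add_right inner_diff_right inner_commute algebra_simps)
qed

text \<open>
  This identity plays the part of the law of cosines in the analysis of projected gradient descent: it
  is what makes the one-step bounds telescope.
\<close>
lemma bregman_three_points:
  "bregman \<Phi> y x - bregman \<Phi> y p - bregman \<Phi> p x = (grad \<Phi> p - grad \<Phi> x) \<bullet> (y - p)"
  by (simp add: bregman_def algebra_simps)

lemma bregman_ge_half_norm_square: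
  assumes "strongly_convex_wrt N 1 S \<Phi>" "x \<in> S" "y \<in> S" and N: "is_norm N"
  shows "bregman \<Phi> y x \<ge> (N (y - x))\<^sup>2 / 2"
proof -
  have "\<Phi> x - \<Phi> y \<le> grad \<Phi> x \<bullet> (x - y) - 1 / 2 * (N (x - y))\<^sup>2"
    using assms unfolding strongly_convex_wrt_def by blast
  then show ?thesis
    by (simp add: bregman_def is_norm_minus_commute[OF N, of x y] algebra_simps)
qed

text \<open>
  Split \<open>x - y = (x - p) + (p - y)\<close>. Optimality of \<open>p\<close> and the three-point identity bound the second
  part by a difference of divergences minus \<open>bregman \<Phi> p x\<close>. That divergence is at least half of
  \<open>(N (x - p))\<^sup>2\<close> by strong convexity, which is exactly what is lost when Young's inequality is applied to
  the first part.
\<close>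
lemma mirror_step_regret:
  fixes \<Phi> N :: "'a::euclidean_space \<Rightarrow> real"
  assumes S: "convex S" and diff: "\<And>z. z \<in> S \<Longrightarrow> \<Phi> differentiable (at z)"
    and N: "is_norm N" and sc: "strongly_convex_wrt N 1 S \<Phi>"
    and min: "is_arg_min (\<lambda>z. \<eta> * (g \<bullet> z) + bregman \<Phi> z x) (\<lambda>z. z \<in> S) p"
    and \<eta>: "\<eta> \<ge> 0" and x: "x \<in> S" and y: "y \<in> S"
  shows "\<eta> * (g \<bullet> (x - y)) \<le> bregman \<Phi> y x - bregman \<Phi> y p + \<eta>\<^sup>2 / 2 * (dual_norm N g)\<^sup>2"
proof -
  have p: "p \<in> S" using min by (simp add: is_arg_min_def)
  have "0 \<le> (\<eta> *\<^sub>R g + grad \<Phi> p - grad \<Phi> x) \<bullet> (y - p)"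
    by (rule mirror_step_first_order[OF S diff min y])
  then have 1: "\<eta> * (g \<bullet> (p - y)) \<le> bregman \<Phi> y x - bregman \<Phi> y p - bregman \<Phi> p x"
    unfolding bregman_three_points by (simp add: algebra_simps)
  have 2: "bregman \<Phi> p x \<ge> (N (x - p))\<^sup>2 / 2"
    using bregman_ge_half_norm_square[OF sc x p N] by (simp add: is_norm_minus_commute[OF N, of x p])
  have "\<eta> * (g \<bullet> (x - p)) \<le> (\<eta> * dual_norm N g) * N (x - p)"
    using mult_left_mono[OF inner_le_dual_norm[OF N] \<eta>] by (simp add: mult.assoc)
  also have "\<dots> \<le> (\<eta> * dual_norm N g)\<^sup>2 / 2 + (N (x - p))\<^sup>2 / 2"
    using sum_squares_bound[of "\<eta> * dual_norm N g" "N (x - p)"] by (simp add: field_simps)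
  finally have 3: "\<eta> * (g \<bullet> (x - p)) \<le> \<eta>\<^sup>2 / 2 * (dual_norm N g)\<^sup>2 + (N (x - p))\<^sup>2 / 2"
    by (simp add: power_mult_distrib)
  have "\<eta> * (g \<bullet> (x - y)) = \<eta> * (g \<bullet> (x - p)) + \<eta> * (g \<bullet> (p - y))"
    by (simp add: algebra_simps)
  with 1 2 3 show ?thesis by linarith
qed

text \<open>
  The divergences telescope. The last one is nonnegative and is dropped; the first is at most
  \<open>\<Phi> y - \<Phi> (x 1)\<close>, by the first-order condition for the minimiser \<open>x 1\<close> of \<open>\<Phi>\<close>. The statement
  is about one fixed sequence of vectors \<open>g s\<close>, without any probability, so that it applies pathwise.
\<close>
lemma mirror_descent_regret:
  fixes \<Phi> N :: "'a::euclidean_space \<Rightarrow> real"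
  assumes S: "convex S" and diff: "\<And>z. z \<in> S \<Longrightarrow> \<Phi> differentiable (at z)"
    and N: "is_norm N" and sc: "strongly_convex_wrt N 1 S \<Phi>" and \<eta>: "\<eta> \<ge> 0"
    and min: "\<And>s. s \<ge> 1 \<Longrightarrow>
      is_arg_min (\<lambda>z. \<eta> * (g s \<bullet> z) + bregman \<Phi> z (x s)) (\<lambda>z. z \<in> S) (x (Suc s))"
    and x1: "is_arg_min \<Phi> (\<lambda>z. z \<in> S) (x 1)" and y: "y \<in> S"
  shows "(\<Sum>s=1..t. \<eta> * (g s \<bullet> (x s - y)))
      \<le> \<Phi> y - \<Phi> (x 1) + (\<Sum>s=1..t. \<eta>\<^sup>2 / 2 * (dual_norm N (g s))\<^sup>2)"
proof -
  have x: "x s \<in> S" if "s \<ge> 1" for s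
  proof (cases "s = 1")
    case True
    then show ?thesis using x1 by (simp add: is_arg_min_def)
  next
    case False
    with that obtain r where "s = Suc r" "r \<ge> 1" by (cases s) auto
    then show ?thesis using min[of r] by (simp add: is_arg_min_def)
  qed
  have "(\<Sum>s=1..t. \<eta> * (g s \<bullet> (x s - y)))
      \<le> bregman \<Phi> y (x 1) - bregman \<Phi> y (x (Suc t)) + (\<Sum>s=1..t. \<eta>\<^sup>2 / 2 * (dual_norm N (g s))\<^sup>2)"
  proof (induction t)
    case (Suc t)
    have "\<eta> * (g (Suc t) \<bullet> (x (Suc t) - y)) \<le> bregman \<Phi> y (x (Suc t))
        - bregman \<Phi> y (x (Suc (Suc t))) + \<eta>\<^sup>2 / 2 * (dual_norm N (g (Suc t)))\<^sup>2"
      by (rule mirror_step_regret[OF S diff N sc min \<eta> x y]) auto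
    with Suc.IH show ?case by simp
  qed simp
  moreover have "bregman \<Phi> y (x (Suc t)) \<ge> 0"
    by (rule order_trans[OF _ bregman_ge_half_norm_square[OF sc x y N]]) auto
  moreover have "0 \<le> grad \<Phi> (x 1) \<bullet> (y - x 1)"
    using x by (intro arg_min_first_order[OF S x1 gderiv_grad[OF diff] y]) auto
  then have "bregman \<Phi> y (x 1) \<le> \<Phi> y - \<Phi> (x 1)" by (simp add: bregman_def)
  ultimately show ?thesis by linarith
qed

section \<open>Measurability of the iterates\<close>

lemma borel_measurable_continuous_on_values:
  fixes f :: "'a::topological_space \<Rightarrow> 'b::topological_space"
  assumes "continuous_on S f" "V \<in> borel_measurable M" "\<And>\<omega>. \<omega> \<in> space M \<Longrightarrow> V \<omega> \<in> S"
  shows "(\<lambda>\<omega>. f (V \<omega>)) \<in> borel_measurable M"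
proof -
  have "V \<in> measurable M (restrict_space borel S)"
    using assms(2,3) by (intro measurable_restrict_space2) auto
  then show ?thesis
    using borel_measurable_continuous_on_restrict[OF assms(1)] by (rule measurable_compose)
qed

text \<open>
  A quantity that depends on \<open>V\<close> in a Lipschitz way is a function of \<open>V\<close> alone, and this function is
  continuous on the range of \<open>V\<close>. The range need not be a Borel set: measurability with respect to the
  trace of the Borel sets on it is enough.
\<close>
lemma borel_measurable_lipschitz_dependence:
  fixes V :: "'w \<Rightarrow> 'a::real_normed_vector" and p :: "'w \<Rightarrow> 'b::real_normed_vector"
  assumes V: "V \<in> borel_measurable M"
    and lip: "\<And>\<omega> \<omega>'. \<omega> \<in> space M \<Longrightarrow> \<omega>' \<in> space M \<Longrightarrow> norm (p \<omega> - p \<omega>') \<le> L * norm (V \<omega> - V \<omega>')"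
  shows "p \<in> borel_measurable M"
proof -
  \<comment> \<open>The hypothesis makes \<open>p\<close> constant on the fibres of \<open>V\<close>, so the choice of a point does not matter.\<close>
  define F where "F v = p (SOME \<omega>. \<omega> \<in> space M \<and> V \<omega> = v)" for v
  have F: "F (V \<omega>) = p \<omega>" if "\<omega> \<in> space M" for \<omega>
  proof -
    let ?w = "SOME \<omega>'. \<omega>' \<in> space M \<and> V \<omega>' = V \<omega>"
    have "\<exists>\<omega>'. \<omega>' \<in> space M \<and> V \<omega>' = V \<omega>" using that by blast
    then have "?w \<in> space M \<and> V ?w = V \<omega>" by (rule someI_ex)
    then show ?thesis using lip[OF _ that, of ?w] by (simp add: F_def)
  qed
  have "\<bar>L\<bar>-lipschitz_on (V ` space M) F"
  proof (rule lipschitz_onI)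
    fix a b assume "a \<in> V ` space M" "b \<in> V ` space M"
    then obtain \<omega> \<omega>' where w: "\<omega> \<in> space M" "\<omega>' \<in> space M" "a = V \<omega>" "b = V \<omega>'" by auto
    have "norm (p \<omega> - p \<omega>') \<le> L * norm (V \<omega> - V \<omega>')" using lip w by blast
    also have "\<dots> \<le> \<bar>L\<bar> * norm (V \<omega> - V \<omega>')" by (intro mult_right_mono) auto
    finally show "dist (F a) (F b) \<le> \<bar>L\<bar> * dist a b" using w F by (simp add: dist_norm)
  qed simp
  then have "continuous_on (V ` space M) F" by (rule lipschitz_on_continuous_on)
  then have "(\<lambda>\<omega>. F (V \<omega>)) \<in> borel_measurable M"
    by (rule borel_measurable_continuous_on_values[OF _ V]) auto
  then show ?thesis using F by (subst measurable_cong[of _ _ "\<lambda>\<omega>. F (V \<omega>)"]) auto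
qed

text \<open>
  Each directional derivative is the pointwise limit of difference quotients of a measurable function.
\<close>
lemma borel_measurable_grad:
  fixes \<Phi> :: "'a::euclidean_space \<Rightarrow> real"
  assumes D: "open D" and diff: "\<And>z. z \<in> D \<Longrightarrow> \<Phi> differentiable (at z)"
    and V: "V \<in> borel_measurable M" "\<And>\<omega>. \<omega> \<in> space M \<Longrightarrow> V \<omega> \<in> D"
  shows "(\<lambda>\<omega>. grad \<Phi> (V \<omega>)) \<in> borel_measurable M"
proof (subst borel_measurable_euclidean_space, intro ballI)
  fix b :: 'a
  \<comment> \<open>The shifted points in the difference quotients may lie outside \<open>D\<close>, where \<open>\<Phi>\<close> need not be measurable.\<close>
  define \<Psi> where "\<Psi> z = indicat_real D z * \<Phi> z" for z
  have "continuous_on D \<Phi>"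
    using diff by (simp add: continuous_at_imp_continuous_on differentiable_imp_continuous_within)
  then have \<Psi>[measurable]: "\<Psi> \<in> borel_measurable borel"
    using D borel_measurable_continuous_on_indicator[of D \<Phi>] by (simp add: \<Psi>_def[abs_def] borel_open)
  have meas: "(\<lambda>\<omega>. (\<Psi> (V \<omega> + (1 / real (Suc n)) *\<^sub>R b) - \<Psi> (V \<omega>)) / (1 / real (Suc n))) \<in> borel_measurable M" for n
    using V(1) by measurable
  show "(\<lambda>\<omega>. grad \<Phi> (V \<omega>) \<bullet> b) \<in> borel_measurable M"
  proof (rule borel_measurable_LIMSEQ_real[OF _ meas])
    fix \<omega> assume "\<omega> \<in> space M"
    then have v: "V \<omega> \<in> D" by (rule V(2))
    let ?v = "V \<omega>"
    have hd: "(\<Phi> has_derivative (\<lambda>h. h \<bullet> grad \<Phi> ?v)) (at ?v)"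
      using gderiv_grad[OF diff[OF v]] by (simp add: gderiv_def)
    have "(\<Psi> has_derivative (\<lambda>h. h \<bullet> grad \<Phi> ?v)) (at ?v)"
      by (rule has_derivative_transform_within_open[OF hd D v]) (simp add: \<Psi>_def)
    then have "((\<lambda>u. \<Psi> (?v + u *\<^sub>R b)) has_real_derivative (grad \<Phi> ?v \<bullet> b)) (at 0)"
      by (intro gderiv_along_line) (simp add: gderiv_def)
    then have lim: "((\<lambda>u. (\<Psi> (?v + u *\<^sub>R b) - \<Psi> ?v) / u) \<longlongrightarrow> grad \<Phi> ?v \<bullet> b) (at 0)"
      by (simp add: DERIV_def)
    have "filterlim (\<lambda>n. 1 / real (Suc n)) (at 0) sequentially"
      using LIMSEQ_inverse_real_of_nat by (simp add: filterlim_at inverse_eq_divide)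
    from filterlim_compose[OF lim this]
    show "(\<lambda>n. (\<Psi> (V \<omega> + (1 / real (Suc n)) *\<^sub>R b) - \<Psi> (V \<omega>)) / (1 / real (Suc n)))
        \<longlonglongrightarrow> grad \<Phi> (V \<omega>) \<bullet> b" .
  qed
qed

text \<open>
  The step minimises \<open>\<Phi> z + V \<omega> \<bullet> z\<close> for \<open>V = \<eta> G - \<nabla>\<Phi>(q)\<close>, up to a term that does not depend on \<open>z\<close>.
  Testing the optimality condition of each of two minimisers with the other, and adding, shows that the
  minimiser is a Lipschitz function of \<open>V \<omega>\<close>, since strong convexity makes \<open>\<nabla>\<Phi>\<close> strongly monotone. This gives
  uniqueness and measurability at once.
\<close>
lemma borel_measurable_mirror_step:
  fixes \<Phi> N :: "'a::euclidean_space \<Rightarrow> real"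
  assumes N: "is_norm N" and D: "open D" and S: "convex S" "S \<subseteq> D"
    and diff: "\<And>z. z \<in> D \<Longrightarrow> \<Phi> differentiable (at z)"
    and sc: "strongly_convex_wrt N 1 S \<Phi>"
    and q: "q \<in> borel_measurable M" "\<And>\<omega>. \<omega> \<in> space M \<Longrightarrow> q \<omega> \<in> S"
    and G: "G \<in> borel_measurable M"
    and min: "\<And>\<omega>. \<omega> \<in> space M \<Longrightarrow>
      is_arg_min (\<lambda>z. \<eta> * (G \<omega> \<bullet> z) + bregman \<Phi> z (q \<omega>)) (\<lambda>z. z \<in> S) (p \<omega>)"
  shows "p \<in> borel_measurable M"
proof -
  obtain K where K: "K > 0" "\<And>x. norm x \<le> K * N x" using is_norm_bounds_norm[OF N] by metis
  define V where "V \<omega> = \<eta> *\<^sub>R G \<omega> - grad \<Phi> (q \<omega>)" for \<omega>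
  have "(\<lambda>\<omega>. grad \<Phi> (q \<omega>)) \<in> borel_measurable M"
    using S(2) q by (intro borel_measurable_grad[OF D diff]) auto
  then have V: "V \<in> borel_measurable M" using G by (simp add: V_def[abs_def])
  have p: "p \<omega> \<in> S" if "\<omega> \<in> space M" for \<omega> using min[OF that] by (simp add: is_arg_min_def)
  have "norm (p \<omega> - p \<omega>') \<le> K\<^sup>2 * norm (V \<omega> - V \<omega>')" if w: "\<omega> \<in> space M" "\<omega>' \<in> space M" for \<omega> \<omega>'
  proof -
    let ?d = "p \<omega> - p \<omega>'"
    have diffS: "\<And>z. z \<in> S \<Longrightarrow> \<Phi> differentiable (at z)" using diff S(2) by blast
    have "0 \<le> (V \<omega> + grad \<Phi> (p \<omega>)) \<bullet> (p \<omega>' - p \<omega>)"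
      using mirror_step_first_order[OF S(1) diffS min[OF w(1)] p[OF w(2)]] by (simp add: V_def algebra_simps)
    moreover have "0 \<le> (V \<omega>' + grad \<Phi> (p \<omega>')) \<bullet> (p \<omega> - p \<omega>')"
      using mirror_step_first_order[OF S(1) diffS min[OF w(2)] p[OF w(1)]] by (simp add: V_def algebra_simps)
    moreover have "bregman \<Phi> (p \<omega>) (p \<omega>') \<ge> (N ?d)\<^sup>2 / 2"
      by (rule bregman_ge_half_norm_square[OF sc p[OF w(2)] p[OF w(1)] N])
    moreover have "bregman \<Phi> (p \<omega>') (p \<omega>) \<ge> (N ?d)\<^sup>2 / 2"
      using bregman_ge_half_norm_square[OF sc p[OF w(1)] p[OF w(2)] N]
      by (simp add: is_norm_minus_commute[OF N, of "p \<omega>'"])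
    ultimately have "(N ?d)\<^sup>2 \<le> (V \<omega>' - V \<omega>) \<bullet> ?d"
      by (simp add: bregman_def algebra_simps)
    also have "\<dots> \<le> norm (V \<omega> - V \<omega>') * norm ?d"
      using norm_cauchy_schwarz[of "V \<omega>' - V \<omega>" ?d] by (simp add: norm_minus_commute)
    finally have "K\<^sup>2 * (N ?d)\<^sup>2 \<le> K\<^sup>2 * (norm (V \<omega> - V \<omega>') * norm ?d)" by (simp add: mult_left_mono)
    moreover have "(norm ?d)\<^sup>2 \<le> K\<^sup>2 * (N ?d)\<^sup>2"
      using power_mono[OF K(2)[of ?d], of 2] by (simp add: power_mult_distrib)
    ultimately have "norm ?d * norm ?d \<le> (K\<^sup>2 * norm (V \<omega> - V \<omega>')) * norm ?d"
      unfolding mult.assoc power2_eq_square[of "norm ?d", symmetric] by (rule order_trans[rotated])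
    then show ?thesis
    proof (cases "norm ?d = 0")
      case False
      then have "norm ?d > 0" by simp
      then show ?thesis using \<open>norm ?d * norm ?d \<le> _\<close> by (rule mult_right_le_imp_le[rotated])
    qed simp
  qed
  then show ?thesis by (rule borel_measurable_lipschitz_dependence[OF V])
qed

section \<open>What the oracle says about the objective\<close>

text \<open>
  The expected answer at \<open>x\<close> is a subgradient there, and its dual norm is controlled by the second
  moment. Since only some Lipschitz constant is wanted, the first moment is bounded crudely through
  \<open>a \<le> (1 + a\<^sup>2) / 2\<close>.
\<close>
lemma stochastic_oracle_lipschitz:
  fixes N :: "real^'n \<Rightarrow> real"
  assumes N: "is_norm N" and M: "prob_space M" and so: "stochastic_oracle M X f g"
    and sm: "\<And>z. z \<in> X \<Longrightarrow> second_moment_le M N (g z) B"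
    and x: "x \<in> X" and y: "y \<in> X"
  shows "f x - f y \<le> (1 + B\<^sup>2) / 2 * N (x - y)"
proof -
  interpret prob_space M by fact
  have int: "integrable M (g x)" and sub: "f x - f y \<le> integral\<^sup>L M (g x) \<bullet> (x - y)"
    using so x y by (auto simp: stochastic_oracle_def subdifferential_def)
  note sm = second_moment_le_integral[OF N borel_measurable_integrable[OF int] sm[OF x]]
  have N0: "N (x - y) \<ge> 0" by (rule is_norm_nonneg[OF N])
  note sub
  also have "integral\<^sup>L M (g x) \<bullet> (x - y) = (\<integral>\<omega>. g x \<omega> \<bullet> (x - y) \<partial>M)"
    using int by simp
  also have "\<dots> \<le> (\<integral>\<omega>. (1 + (dual_norm N (g x \<omega>))\<^sup>2) / 2 * N (x - y) \<partial>M)"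
  proof (rule integral_mono)
    fix \<omega>
    have "g x \<omega> \<bullet> (x - y) \<le> dual_norm N (g x \<omega>) * N (x - y)" by (rule inner_le_dual_norm[OF N])
    also have "\<dots> \<le> (1 + (dual_norm N (g x \<omega>))\<^sup>2) / 2 * N (x - y)"
      using sum_squares_bound[of 1 "dual_norm N (g x \<omega>)"] by (intro mult_right_mono N0) simp
    finally show "g x \<omega> \<bullet> (x - y) \<le> (1 + (dual_norm N (g x \<omega>))\<^sup>2) / 2 * N (x - y)" .
  qed (use int sm in auto)
  also have "\<dots> = (1 + (\<integral>\<omega>. (dual_norm N (g x \<omega>))\<^sup>2 \<partial>M)) / 2 * N (x - y)"
    using sm(1) by (simp add: prob_space)
  also have "\<dots> \<le> (1 + B\<^sup>2) / 2 * N (x - y)"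
    using sm(2) by (intro mult_right_mono N0) simp
  finally show ?thesis .
qed

text \<open>
  A convex function on a compact convex set may jump at the boundary. The oracle excludes this: it has
  uniformly bounded subgradients at all points of \<open>X\<close>, boundary points included.
\<close>
lemma stochastic_oracle_continuous_on:
  fixes N :: "real^'n \<Rightarrow> real"
  assumes N: "is_norm N" and M: "prob_space M" and so: "stochastic_oracle M X f g"
    and sm: "\<And>z. z \<in> X \<Longrightarrow> second_moment_le M N (g z) B"
  shows "continuous_on X f"
proof (unfold continuous_on, intro ballI)
  fix x assume x: "x \<in> X"
  have cN: "continuous_on UNIV N"
    by (rule convex_on_continuous[OF open_UNIV is_norm_convex_on[OF N]])
  have "continuous_on UNIV (\<lambda>y. (1 + B\<^sup>2) / 2 * N (y - x))"
    by (intro continuous_intros continuous_on_compose2[OF cN]) auto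
  then have "((\<lambda>y. (1 + B\<^sup>2) / 2 * N (y - x)) \<longlongrightarrow> (1 + B\<^sup>2) / 2 * N (x - x)) (at x within X)"
    by (meson UNIV_I continuous_on tendsto_within_subset subset_UNIV)
  then have lim: "((\<lambda>y. (1 + B\<^sup>2) / 2 * N (y - x)) \<longlongrightarrow> 0) (at x within X)"
    by (simp add: is_norm_0[OF N])
  have "\<bar>f y - f x\<bar> \<le> (1 + B\<^sup>2) / 2 * N (y - x)" if "y \<in> X" for y
    using stochastic_oracle_lipschitz[OF N M so sm that x] stochastic_oracle_lipschitz[OF N M so sm x that]
    unfolding is_norm_minus_commute[OF N, of x y] by linarith
  then have "((\<lambda>y. f y - f x) \<longlongrightarrow> 0) (at x within X)"
    by (intro Lim_null_comparison[OF _ lim]) (auto simp: eventually_at_filter)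
  then show "(f \<longlongrightarrow> f x) (at x within X)" by (simp add: LIM_zero_iff)
qed

lemma integrable_continuous_on_compact_values:
  fixes f :: "'a::topological_space \<Rightarrow> real"
  assumes "finite_measure M" "compact X" "continuous_on X f"
    and "q \<in> borel_measurable M" "\<And>\<omega>. \<omega> \<in> space M \<Longrightarrow> q \<omega> \<in> X"
  shows "integrable M (\<lambda>\<omega>. f (q \<omega>))"
proof -
  interpret finite_measure M by fact
  obtain C where "\<And>y. y \<in> f ` X \<Longrightarrow> norm y \<le> C"
    using compact_imp_bounded[OF compact_continuous_image[OF assms(3,2)]] by (auto simp: bounded_iff)
  then show ?thesis
    using assms(5)
    by (intro integrable_const_bound[of _ C] borel_measurable_continuous_on_values[OF assms(3-5)]) auto
qed

lemma integrable_bounded_inner: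
  fixes U G :: "'w \<Rightarrow> 'a::euclidean_space"
  assumes G: "integrable M G" and U: "U \<in> borel_measurable M"
    and bd: "\<And>\<omega>. \<omega> \<in> space M \<Longrightarrow> norm (U \<omega>) \<le> C"
  shows "integrable M (\<lambda>\<omega>. G \<omega> \<bullet> U \<omega>)"
proof (rule Bochner_Integration.integrable_bound)
  show "integrable M (\<lambda>\<omega>. C * norm (G \<omega>))" using G by simp
  show "(\<lambda>\<omega>. G \<omega> \<bullet> U \<omega>) \<in> borel_measurable M" using G U by simp
  have "norm (G \<omega> \<bullet> U \<omega>) \<le> norm (C * norm (G \<omega>))" if "\<omega> \<in> space M" for \<omega>
  proof -
    have "\<bar>G \<omega> \<bullet> U \<omega>\<bar> \<le> norm (G \<omega>) * norm (U \<omega>)" by (rule Cauchy_Schwarz_ineq2)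
    also have "\<dots> \<le> norm (G \<omega>) * C" using bd[OF that] by (intro mult_left_mono) auto
    also have "\<dots> \<le> \<bar>C * norm (G \<omega>)\<bar>" by (simp add: mult.commute)
    finally show ?thesis by simp
  qed
  then show "AE \<omega> in M. norm (G \<omega> \<bullet> U \<omega>) \<le> norm (C * norm (G \<omega>))" by auto
qed

lemma borel_measurable_vec_nth:
  fixes V :: "'w \<Rightarrow> real^'n"
  assumes "V \<in> borel_measurable M"
  shows "(\<lambda>\<omega>. V \<omega> $ i) \<in> borel_measurable M"
  using borel_measurable_inner[OF assms, of "\<lambda>_. axis i 1"] by (simp add: inner_axis)

text \<open>
  The defining property of the conditional expectation, tested componentwise with a bounded function
  of the conditioning variable.
\<close>
lemma integral_vec_cond_exp_inner:
  fixes q V :: "'w \<Rightarrow> real^'n"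
  assumes M: "prob_space M" and q: "q \<in> borel_measurable M" and V: "integrable M V"
    and h: "h \<in> borel_measurable borel"
    and bd: "\<And>\<omega>. \<omega> \<in> space M \<Longrightarrow> norm (h (q \<omega>)) \<le> C"
  shows "integrable M (\<lambda>\<omega>. vec_cond_exp M V q \<omega> \<bullet> h (q \<omega>))"
    and "(\<integral>\<omega>. vec_cond_exp M V q \<omega> \<bullet> h (q \<omega>) \<partial>M) = (\<integral>\<omega>. V \<omega> \<bullet> h (q \<omega>) \<partial>M)"
proof -
  interpret prob_space M by fact
  let ?F = "vimage_algebra (space M) q borel"
  have sub: "subalgebra M ?F"
    unfolding subalgebra_def using q
    by (auto simp: sets_vimage_algebra2 measurable_sets)
  interpret finite_measure_subalgebra M ?F by standard (rule sub)
  have qF: "q \<in> measurable ?F borel" by (intro measurable_vimage_algebra1) auto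
  have hq: "(\<lambda>\<omega>. h (q \<omega>)) \<in> borel_measurable M" using h q by measurable
  have hF: "(\<lambda>\<omega>. h (q \<omega>) $ i) \<in> borel_measurable ?F" for i
    by (intro measurable_compose[OF qF, of "\<lambda>z. h z $ i"] borel_measurable_vec_nth h)
  have int: "integrable M (\<lambda>\<omega>. h (q \<omega>) $ i * V \<omega> $ i)" for i
  proof -
    have "integrable M (\<lambda>\<omega>. V \<omega> \<bullet> ((h (q \<omega>) $ i) *\<^sub>R axis i 1))"
    proof (rule integrable_bounded_inner[OF V])
      show "(\<lambda>\<omega>. (h (q \<omega>) $ i) *\<^sub>R axis i 1 :: real^'n) \<in> borel_measurable M"
        by (intro borel_measurable_scaleR borel_measurable_vec_nth hq borel_measurable_const)
      show "norm ((h (q \<omega>) $ i) *\<^sub>R axis i 1 :: real^'n) \<le> C" if "\<omega> \<in> space M" for \<omega>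
        using bd[OF that] component_le_norm_cart[of "h (q \<omega>)" i] by (simp add: norm_axis_1)
    qed
    then show ?thesis by (simp add: inner_axis mult.commute)
  qed
  have Vi: "(\<lambda>\<omega>. V \<omega> $ i) \<in> borel_measurable M" for i
    using V by (intro borel_measurable_vec_nth) auto
  note ce = real_cond_exp_intg[OF int hF Vi]
  have eq: "vec_cond_exp M V q \<omega> \<bullet> h (q \<omega>)
      = (\<Sum>i\<in>UNIV. h (q \<omega>) $ i * real_cond_exp M ?F (\<lambda>\<omega>. V \<omega> $ i) \<omega>)" for \<omega>
    by (simp add: vec_cond_exp_def inner_vec_def mult.commute)
  show "integrable M (\<lambda>\<omega>. vec_cond_exp M V q \<omega> \<bullet> h (q \<omega>))"
    unfolding eq using ce(1) by (intro Bochner_Integration.integrable_sum) auto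
  have "(\<integral>\<omega>. vec_cond_exp M V q \<omega> \<bullet> h (q \<omega>) \<partial>M) = (\<Sum>i\<in>UNIV. (\<integral>\<omega>. h (q \<omega>) $ i * V \<omega> $ i \<partial>M))"
    unfolding eq using ce by (subst Bochner_Integration.integral_sum) auto
  also have "\<dots> = (\<integral>\<omega>. V \<omega> \<bullet> h (q \<omega>) \<partial>M)"
    using int by (subst Bochner_Integration.integral_sum[symmetric]) (auto simp: inner_vec_def mult.commute)
  finally show "(\<integral>\<omega>. vec_cond_exp M V q \<omega> \<bullet> h (q \<omega>) \<partial>M) = (\<integral>\<omega>. V \<omega> \<bullet> h (q \<omega>) \<partial>M)" .
qed

text \<open>
  The conditional expectation of the answer given the query point \<open>q\<close> is almost surely a subgradient at
  \<open>q\<close>, and \<open>q - y\<close> is a function of \<open>q\<close>. Hence in the subgradient inequality, after integration, the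
  conditional expectation may be replaced by the answer itself.
\<close>
lemma stochastic_oracle_at_suboptimality:
  fixes q :: "'w \<Rightarrow> real^'n"
  assumes M: "prob_space M" and X: "bounded X" and y: "y \<in> X"
    and q: "q \<in> borel_measurable M" "\<And>\<omega>. \<omega> \<in> space M \<Longrightarrow> q \<omega> \<in> X"
    and so: "stochastic_oracle_at M X f g q" and f: "integrable M (\<lambda>\<omega>. f (q \<omega>))"
  shows "integrable M (\<lambda>\<omega>. g (q \<omega>) \<omega> \<bullet> (q \<omega> - y))"
    and "(\<integral>\<omega>. f (q \<omega>) \<partial>M) - f y \<le> (\<integral>\<omega>. g (q \<omega>) \<omega> \<bullet> (q \<omega> - y) \<partial>M)"
proof -
  interpret prob_space M by fact
  obtain C where C: "\<And>z. z \<in> X \<Longrightarrow> norm z \<le> C" using X by (auto simp: bounded_iff)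
  have bd: "norm (q \<omega> - y) \<le> C + norm y" if "\<omega> \<in> space M" for \<omega>
    using norm_triangle_ineq4[of "q \<omega>" y] C[OF q(2)[OF that]] by linarith
  have G: "integrable M (\<lambda>\<omega>. g (q \<omega>) \<omega>)"
    and sub: "AE \<omega> in M. vec_cond_exp M (\<lambda>\<omega>'. g (q \<omega>') \<omega>') q \<omega> \<in> subdifferential X f (q \<omega>)"
    using so by (auto simp: stochastic_oracle_at_def)
  show "integrable M (\<lambda>\<omega>. g (q \<omega>) \<omega> \<bullet> (q \<omega> - y))"
    by (rule integrable_bounded_inner[OF G _ bd]) (use q(1) in measurable)
  have h: "(\<lambda>z. z - y) \<in> borel_measurable borel" by simp
  note ce = integral_vec_cond_exp_inner[OF M q(1) G h bd]
  have "(\<integral>\<omega>. f (q \<omega>) \<partial>M) - f y = (\<integral>\<omega>. f (q \<omega>) - f y \<partial>M)"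
    using f by (simp add: prob_space)
  also have "\<dots> \<le> (\<integral>\<omega>. vec_cond_exp M (\<lambda>\<omega>'. g (q \<omega>') \<omega>') q \<omega> \<bullet> (q \<omega> - y) \<partial>M)"
  proof (rule integral_mono_AE)
    show "AE \<omega> in M. f (q \<omega>) - f y \<le> vec_cond_exp M (\<lambda>\<omega>'. g (q \<omega>') \<omega>') q \<omega> \<bullet> (q \<omega> - y)"
      using sub by eventually_elim (use y in \<open>auto simp: subdifferential_def\<close>)
  qed (use f ce(1) in auto)
  also note ce(2)
  finally show "(\<integral>\<omega>. f (q \<omega>) \<partial>M) - f y \<le> (\<integral>\<omega>. g (q \<omega>) \<omega> \<bullet> (q \<omega> - y) \<partial>M)" .
qed

section \<open>The convergence rate\<close>

text \<open>
  The half-open segment from a point of \<open>X \<inter> D\<close> to any point of \<open>X\<close> lies in both sets. Thus a bound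
  against comparison points in \<open>X \<inter> D\<close>, the only ones where \<open>\<Phi>\<close> is controlled, extends to \<open>X\<close> by continuity of the objective.
\<close>
lemma subset_closure_Int_open:
  fixes X D :: "'a::euclidean_space set"
  assumes "convex X" "convex D" "open D" "X \<subseteq> closure D" "X \<inter> D \<noteq> {}"
  shows "X \<subseteq> closure (X \<inter> D)"
proof
  fix x assume x: "x \<in> X"
  obtain a where a: "a \<in> X" "a \<in> D" using assms(5) by blast
  show "x \<in> closure (X \<inter> D)"
  proof (cases "a = x")
    case True
    then show ?thesis using a closure_subset[of "X \<inter> D"] by auto
  next
    case False
    have "open_segment a x \<subseteq> interior D"
      using assms a x by (intro in_interior_closure_convex_segment) (auto simp: interior_open)
    moreover have "open_segment a x \<subseteq> X"
      using closed_segment_subset[OF a(1) x assms(1)] open_closed_segment by blast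
    ultimately have "closure (open_segment a x) \<subseteq> closure (X \<inter> D)"
      using interior_subset by (intro closure_mono) blast
    then show ?thesis using False by (auto simp: closure_open_segment)
  qed
qed

text \<open>
  This serves the case \<open>R = 0\<close>, where it forces \<open>X \<inter> D\<close> to be a single point.
\<close>
lemma arg_min_quadratic_growth:
  fixes \<Phi> N :: "'a::euclidean_space \<Rightarrow> real"
  assumes S: "convex S" and N: "is_norm N" and sc: "strongly_convex_wrt N 1 S \<Phi>"
    and min: "is_arg_min \<Phi> (\<lambda>z. z \<in> S) p" and diff: "\<Phi> differentiable (at p)" and z: "z \<in> S"
  shows "(N (z - p))\<^sup>2 / 2 \<le> \<Phi> z - \<Phi> p"
proof -
  have p: "p \<in> S" using min by (simp add: is_arg_min_def)
  have "0 \<le> grad \<Phi> p \<bullet> (z - p)" by (rule arg_min_first_order[OF S min gderiv_grad[OF diff] z])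
  then show ?thesis
    using bregman_ge_half_norm_square[OF sc p z N] by (simp add: bregman_def)
qed

theorem theorem6p1:
  fixes N :: "real^'n \<Rightarrow> real"
    and X D :: "(real^'n) set"
    and \<Phi> f :: "real^'n \<Rightarrow> real"
    and x1 :: "real^'n"
    and R B \<eta> :: real
    and t :: nat
    and M :: "'w measure"
    and g :: "nat \<Rightarrow> real^'n \<Rightarrow> 'w \<Rightarrow> real^'n"
    and x :: "nat \<Rightarrow> 'w \<Rightarrow> real^'n"
  assumes "is_norm N"
    and "compact X" and "convex X"
    and "convex D" and "open D" and "X \<subseteq> closure D" and "X \<inter> D \<noteq> {}"
    and "mirror_map N D \<Phi>"
    and "strongly_convex_wrt N 1 (X \<inter> D) \<Phi>"
    and "is_arg_min \<Phi> (\<lambda>z. z \<in> X \<inter> D) x1"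
    and "bdd_above (\<Phi> ` (X \<inter> D))"
    and "R \<ge> 0" and "R\<^sup>2 = (SUP z\<in>X \<inter> D. \<Phi> z) - \<Phi> x1"
    and "convex_on X f"
    and "prob_space M"
    and "B > 0"
    and "\<And>s. s \<ge> 1 \<Longrightarrow> stochastic_oracle M X f (g s)"
    and "\<And>s z. s \<ge> 1 \<Longrightarrow> z \<in> X \<Longrightarrow> second_moment_le M N (g s z) B"
    and "t \<ge> 1"
    and "\<eta> = R / B * sqrt (2 / real t)"
    and "stochastic_mirror_descent M X D \<Phi> \<eta> x1 g x"
    and "\<And>s. s \<ge> 1 \<Longrightarrow> stochastic_oracle_at M X f (g s) (x s)"
    and "\<And>s. s \<ge> 1 \<Longrightarrow> second_moment_le M N (\<lambda>\<omega>. g s (x s \<omega>) \<omega>) B"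
  shows "integrable M (\<lambda>\<omega>. f ((1 / real t) *\<^sub>R (\<Sum>s=1..t. x s \<omega>))) \<and>
    (\<exists>xmin. is_arg_min f (\<lambda>z. z \<in> X) xmin \<and>
       integral\<^sup>L M (\<lambda>\<omega>. f ((1 / real t) *\<^sub>R (\<Sum>s=1..t. x s \<omega>))) - f xmin
         \<le> R * B * sqrt (2 / real t))"
proof -
  note N = assms(1) and compX = assms(2) and convX = assms(3) and D = assms(4,5)
    and x1 = assms(10) and R = assms(12,13) and M = assms(15) and B = assms(16) and t = assms(19)
  interpret prob_space M by (rule M)
  define S where "S = X \<inter> D"
  have S: "convex S" "S \<subseteq> D" "S \<subseteq> X" using convX D by (auto simp: S_def convex_Int)
  have sc: "strongly_convex_wrt N 1 S \<Phi>" using assms(9) by (simp add: S_def)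
  have diff: "\<Phi> differentiable (at z)" if "z \<in> D" for z
    using assms(8) that by (simp add: mirror_map_def)
  have diffS: "\<Phi> differentiable (at z)" if "z \<in> S" for z using diff S(2) that by blast
  have minS: "is_arg_min \<Phi> (\<lambda>z. z \<in> S) x1" using x1 by (simp add: S_def)
  have start: "x 1 \<omega> = x1" if "\<omega> \<in> space M" for \<omega>
    using assms(21) that by (simp add: stochastic_mirror_descent_def)
  have step: "is_arg_min (\<lambda>z. \<eta> * (g s (x s \<omega>) \<omega> \<bullet> z) + bregman \<Phi> z (x s \<omega>)) (\<lambda>z. z \<in> S) (x (Suc s) \<omega>)"
    if "\<omega> \<in> space M" "s \<ge> 1" for s \<omega>
    using assms(21) that by (simp add: stochastic_mirror_descent_def S_def)
  have G: "integrable M (\<lambda>\<omega>. g s (x s \<omega>) \<omega>)" if "s \<ge> 1" for s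
    using assms(22)[OF that] by (simp add: stochastic_oracle_at_def)
  have cont: "continuous_on X f"
    using stochastic_oracle_continuous_on[OF N M assms(17)[OF order_refl] assms(18)[OF order_refl]] .

  have iter: "x s \<in> borel_measurable M \<and> (\<forall>\<omega>\<in>space M. x s \<omega> \<in> S)" if "s \<ge> 1" for s
    using that
  proof (induction s rule: nat_induct_at_least)
    case base
    have "x 1 \<in> borel_measurable M \<longleftrightarrow> (\<lambda>_. x1) \<in> borel_measurable M"
      by (rule measurable_cong) (rule start)
    then show ?case using minS start by (simp add: is_arg_min_def)
  next
    case (Suc s)
    have "x (Suc s) \<in> borel_measurable M"
      using Suc G[OF Suc.hyps]
      by (intro borel_measurable_mirror_step[OF N D(2) S(1,2) diff sc _ _ _ step]) auto
    then show ?case using step[OF _ Suc.hyps] by (auto simp: is_arg_min_def)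
  qed
  then have meas: "x s \<in> borel_measurable M" and inS: "\<omega> \<in> space M \<Longrightarrow> x s \<omega> \<in> S"
    if "s \<ge> 1" for s \<omega> using that by auto
  have inX: "x s \<omega> \<in> X" if "s \<ge> 1" "\<omega> \<in> space M" for s \<omega> using inS[OF that] S(3) by blast

  define avg where "avg \<omega> = (1 / real t) *\<^sub>R (\<Sum>s=1..t. x s \<omega>)" for \<omega>
  have avg_sum: "avg \<omega> = (\<Sum>s=1..t. (1 / real t) *\<^sub>R x s \<omega>)" for \<omega>
    by (simp add: avg_def scaleR_sum_right)
  have avgX: "avg \<omega> \<in> X" if "\<omega> \<in> space M" for \<omega>
    unfolding avg_sum using t inX that by (intro convex_sum convX) auto
  have avg_meas: "avg \<in> borel_measurable M"
    unfolding avg_def[abs_def] using meas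
    by (intro borel_measurable_scaleR borel_measurable_const borel_measurable_sum) auto
  have int_avg: "integrable M (\<lambda>\<omega>. f (avg \<omega>))"
    by (rule integrable_continuous_on_compact_values[OF finite_measure_axioms compX cont avg_meas avgX])
  have int_f: "integrable M (\<lambda>\<omega>. f (x s \<omega>))" if "s \<ge> 1" for s
    by (rule integrable_continuous_on_compact_values[OF finite_measure_axioms compX cont meas[OF that] inX[OF that]])

  have gap: "\<Phi> z - \<Phi> x1 \<le> R\<^sup>2" if "z \<in> S" for z
    using cSUP_upper[OF _ assms(11), of z] that R(2) by (simp add: S_def)

  have main: "(\<integral>\<omega>. f (avg \<omega>) \<partial>M) - f y \<le> R * B * sqrt (2 / real t)" if y: "y \<in> S" for y
  proof (cases "R = 0")
    case True
    have single: "z = x1" if "z \<in> S" for z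
    proof -
      have "x1 \<in> S" using minS by (simp add: is_arg_min_def)
      then have "(N (z - x1))\<^sup>2 / 2 \<le> \<Phi> z - \<Phi> x1"
        using that by (intro arg_min_quadratic_growth[OF S(1) N sc minS diffS])
      also have "\<dots> \<le> 0" using gap[OF that] True by simp
      finally have "N (z - x1) = 0" by simp
      then show ?thesis by (simp add: is_norm_eq_0_iff[OF N])
    qed
    have "avg \<omega> = y" if "\<omega> \<in> space M" for \<omega>
    proof -
      have "(\<Sum>s=1..t. x s \<omega>) = (\<Sum>s=1..t. x1)"
        using single[OF inS[OF _ that]] by (intro sum.cong) auto
      then show ?thesis using t single[OF y] by (simp add: avg_def sum_constant_scaleR del: sum_constant)
    qed
    then have "(\<integral>\<omega>. f (avg \<omega>) \<partial>M) = (\<integral>\<omega>. f y \<partial>M)" by (intro Bochner_Integration.integral_cong) auto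
    then show ?thesis using True by (simp add: prob_space)
  next
    case False
    then have R0: "R > 0" using R(1) by simp
    have \<eta>: "\<eta> > 0" using R0 B t assms(20) by simp
    have yX: "y \<in> X" using y S(3) by blast
    let ?g = "\<lambda>s \<omega>. g s (x s \<omega>) \<omega>"
    note subopt = stochastic_oracle_at_suboptimality[OF M compact_imp_bounded[OF compX] yX
        meas inX assms(22) int_f]
    note moment = second_moment_le_integral[OF N borel_measurable_integrable[OF G] assms(23)]
    have regret: "(\<Sum>s=1..t. \<eta> * (?g s \<omega> \<bullet> (x s \<omega> - y)))
        \<le> R\<^sup>2 + (\<Sum>s=1..t. \<eta>\<^sup>2 / 2 * (dual_norm N (?g s \<omega>))\<^sup>2)" if w: "\<omega> \<in> space M" for \<omega>
      using mirror_descent_regret[OF S(1) diffS N sc, of \<eta> "\<lambda>s. ?g s \<omega>" "\<lambda>s. x s \<omega>" y t]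
        step[OF w] start[OF w] minS \<eta> y gap[OF y] by simp
    have "(\<Sum>s=1..t. \<eta> * ((\<integral>\<omega>. f (x s \<omega>) \<partial>M) - f y))
        \<le> (\<Sum>s=1..t. \<eta> * (\<integral>\<omega>. ?g s \<omega> \<bullet> (x s \<omega> - y) \<partial>M))"
      using subopt(2) \<eta> by (intro sum_mono mult_left_mono) auto
    also have "\<dots> = (\<integral>\<omega>. (\<Sum>s=1..t. \<eta> * (?g s \<omega> \<bullet> (x s \<omega> - y))) \<partial>M)"
      using subopt(1) by (subst Bochner_Integration.integral_sum) auto
    also have "\<dots> \<le> (\<integral>\<omega>. R\<^sup>2 + (\<Sum>s=1..t. \<eta>\<^sup>2 / 2 * (dual_norm N (?g s \<omega>))\<^sup>2) \<partial>M)"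
      using subopt(1) moment(1) regret
      by (intro integral_mono Bochner_Integration.integrable_add Bochner_Integration.integrable_sum
          integrable_mult_right) auto
    also have "\<dots> = R\<^sup>2 + (\<Sum>s=1..t. \<eta>\<^sup>2 / 2 * (\<integral>\<omega>. (dual_norm N (?g s \<omega>))\<^sup>2 \<partial>M))"
      using moment(1)
      by (subst Bochner_Integration.integral_add) (auto simp: prob_space Bochner_Integration.integral_sum)
    also have "\<dots> \<le> R\<^sup>2 + (\<Sum>s=1..t. \<eta>\<^sup>2 / 2 * B\<^sup>2)"
      using moment(2) by (intro add_left_mono sum_mono mult_left_mono) auto
    \<comment> \<open>The choice of \<open>\<eta>\<close> makes both contributions equal to \<open>R\<^sup>2\<close>.\<close>
    also have "\<dots> = 2 * R\<^sup>2"
    proof -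
      have "\<eta>\<^sup>2 = R\<^sup>2 / B\<^sup>2 * (2 / real t)"
        unfolding assms(20) power_mult_distrib power_divide by simp
      then show ?thesis using t B by (simp add: field_simps)
    qed
    finally have "\<eta> * (\<Sum>s=1..t. (\<integral>\<omega>. f (x s \<omega>) \<partial>M) - f y) \<le> 2 * R\<^sup>2"
      by (simp only: sum_distrib_left)
    then have "(\<Sum>s=1..t. (\<integral>\<omega>. f (x s \<omega>) \<partial>M)) - real t * f y \<le> 2 * R\<^sup>2 / \<eta>"
      using \<eta> by (simp add: field_simps sum_subtractf)
    then have "1 / real t * ((\<Sum>s=1..t. (\<integral>\<omega>. f (x s \<omega>) \<partial>M)) - real t * f y) \<le> 1 / real t * (2 * R\<^sup>2 / \<eta>)"
      by (rule mult_left_mono) simp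
    also have "1 / real t * (2 * R\<^sup>2 / \<eta>) = R * B * sqrt (2 / real t)"
    proof -
      define r where "r = sqrt (2 / real t)"
      have r2: "r * r = 2 / real t" by (simp add: r_def)
      have "R * B * r * \<eta> = R\<^sup>2 * (r * r)"
        unfolding assms(20) r_def[symmetric] using B by (simp add: power2_eq_square)
      then have "R * B * sqrt (2 / real t) * \<eta> = R\<^sup>2 * (2 / real t)"
        by (simp only: r2 flip: r_def)
      then show ?thesis using \<eta> t by (simp add: field_simps)
    qed
    finally have "1 / real t * (\<Sum>s=1..t. (\<integral>\<omega>. f (x s \<omega>) \<partial>M)) - f y \<le> R * B * sqrt (2 / real t)"
      using t by (simp add: field_simps)
    moreover have "(\<integral>\<omega>. f (avg \<omega>) \<partial>M) \<le> 1 / real t * (\<Sum>s=1..t. (\<integral>\<omega>. f (x s \<omega>) \<partial>M))"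
    proof -
      have "(\<integral>\<omega>. f (avg \<omega>) \<partial>M) \<le> (\<integral>\<omega>. (\<Sum>s=1..t. 1 / real t * f (x s \<omega>)) \<partial>M)"
      proof (rule integral_mono[OF int_avg])
        show "integrable M (\<lambda>\<omega>. \<Sum>s=1..t. 1 / real t * f (x s \<omega>))"
          using int_f by (intro Bochner_Integration.integrable_sum integrable_mult_right) auto
        show "f (avg \<omega>) \<le> (\<Sum>s=1..t. 1 / real t * f (x s \<omega>))" if "\<omega> \<in> space M" for \<omega>
          unfolding avg_sum using t inX that by (intro convex_on_sum[OF _ _ assms(14)]) auto
      qed
      also have "\<dots> = 1 / real t * (\<Sum>s=1..t. (\<integral>\<omega>. f (x s \<omega>) \<partial>M))"
        using int_f by (subst Bochner_Integration.integral_sum) (auto simp: sum_distrib_left)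
      finally show ?thesis .
    qed
    ultimately show ?thesis by linarith
  qed

  have "X \<noteq> {}" using assms(7) by blast
  then obtain xmin where xmin: "xmin \<in> X" "\<And>z. z \<in> X \<Longrightarrow> f xmin \<le> f z"
    using continuous_attains_inf[OF compX _ cont] by blast
  \<comment> \<open>The minimiser of \<open>f\<close> may lie on the boundary of \<open>D\<close>, outside \<open>S\<close>; continuity of \<open>f\<close> carries the bound there.\<close>
  have "closure S \<subseteq> X" using S(3) compX by (simp add: closure_minimal compact_imp_closed)
  then have "continuous_on (closure S) f" using cont continuous_on_subset by blast
  moreover have "xmin \<in> closure S"
    using subset_closure_Int_open[OF convX D assms(6,7)] xmin(1) by (auto simp: S_def)
  moreover have "(\<integral>\<omega>. f (avg \<omega>) \<partial>M) - R * B * sqrt (2 / real t) \<le> f y" if "y \<in> S" for y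
    using main[OF that] by simp
  ultimately have "(\<integral>\<omega>. f (avg \<omega>) \<partial>M) - R * B * sqrt (2 / real t) \<le> f xmin"
    by (rule continuous_ge_on_closure)
  moreover have "is_arg_min f (\<lambda>z. z \<in> X) xmin"
    using xmin by (auto simp: is_arg_min_def not_less)
  ultimately show ?thesis
    using int_avg unfolding avg_def by (intro conjI exI[of _ xmin]) auto
qed

end
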